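(* Let $(u,\mathbf B)$ (with pressure $P$) be a solution on $\mathbb{R}^2$ of $$\begin{cases}\partial_t u+u\cdot\nabla u-\mathbf B\cdot\nabla\mathbf B+\nabla\left(P+\tfrac12|\mathbf B|^2\right)=\Delta u,\\ \partial_t\mathbf B-\nabla\times(u\times\mathbf B)=0,\qquad \operatorname{div}u=\operatorname{div}\mathbf B=0,\end{cases}$$ and let $F$, with values in the $2\times2$ matrices of positive determinant, satisfy $\partial_tF+u\cdot\nabla F=\nabla u\,F$. Put $A=F^{-1}$, and let $A_0,\mathbf B_0$ denote the values of $A,\mathbf B$ at $t=0$. Then, along the flow map of $u$, $$A\mathbf B(t)=A_0\mathbf B_0\quad\text{for all }t\ge0,$$ i.e. $A(t,x(t,\alpha))\,\mathbf B(t,x(t,\alpha))=A_0(\alpha)\mathbf B_0(\alpha)$ for all $t\ge0$ and $\alpha\in\mathbb{R}^2$.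
   Context: Solutions are classical (smooth enough for the equations to hold pointwise). The flow map is defined by $\frac{d}{dt}x(t,\alpha)=u(t,x(t,\alpha))$, $x(0,\alpha)=\alpha$. $(\nabla u)_{ij}=\partial_{x_j}u_i$. For divergence-free planar fields, $\nabla\times(u\times\mathbf B)=\mathbf B\cdot\nabla u-u\cdot\nabla\mathbf B$. *)

theory Defs
  imports "HOL-Analysis.Analysis"
begin

text \<open>
  A time-dependent field on the plane is a function of type
  \<open>real \<Rightarrow> real^2 \<Rightarrow> 'a\<close>; only its values at times \<open>t \<ge> 0\<close> are ever constrained.
\<close>

subsection \<open>Differential operators\<close>

definition partial_deriv :: "2 \<Rightarrow> (real^2 \<Rightarrow> 'a::real_normed_vector) \<Rightarrow> real^2 \<Rightarrow> 'a" where
  "partial_deriv j f x = vector_derivative (\<lambda>s. f (x + s *\<^sub>R axis j 1)) (at 0)"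

definition time_deriv :: "(real \<Rightarrow> real^2 \<Rightarrow> 'a::real_normed_vector) \<Rightarrow> real \<Rightarrow> real^2 \<Rightarrow> 'a" where
  "time_deriv f t x = vector_derivative (\<lambda>s. f s x) (at t)"

text \<open>\<open>advect v f = v \<cdot> \<nabla>f\<close>, componentwise for vector- and matrix-valued \<open>f\<close>.\<close>
definition advect :: "(real^2 \<Rightarrow> real^2) \<Rightarrow> (real^2 \<Rightarrow> 'a::real_normed_vector) \<Rightarrow> real^2 \<Rightarrow> 'a" where
  "advect v f x = (\<Sum>j\<in>UNIV. v x $ j *\<^sub>R partial_deriv j f x)"

definition grad :: "(real^2 \<Rightarrow> real) \<Rightarrow> real^2 \<Rightarrow> real^2" where
  "grad p x = (\<chi> j. partial_deriv j p x)"

definition divergence :: "(real^2 \<Rightarrow> real^2) \<Rightarrow> real^2 \<Rightarrow> real" where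
  "divergence v x = (\<Sum>j\<in>UNIV. partial_deriv j (\<lambda>y. v y $ j) x)"

definition laplacian :: "(real^2 \<Rightarrow> 'a::real_normed_vector) \<Rightarrow> real^2 \<Rightarrow> 'a" where
  "laplacian f x = (\<Sum>j\<in>UNIV. partial_deriv j (partial_deriv j f) x)"

text \<open>
  Planar fields are identified with fields \<open>(v\<^sub>1, v\<^sub>2, 0)\<close> on three-space that do not
  depend on the third coordinate.  The cross product of two of them is \<open>(0, 0, \<phi>)\<close> with
  \<open>\<phi> = cross2 v w\<close>, and the curl of \<open>(0, 0, \<phi>)\<close> is \<open>(\<partial>\<^sub>2\<phi>, -\<partial>\<^sub>1\<phi>, 0)\<close>.
\<close>
definition cross2 :: "real^2 \<Rightarrow> real^2 \<Rightarrow> real" where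
  "cross2 v w = v $ 1 * w $ 2 - v $ 2 * w $ 1"

definition curl_scalar :: "(real^2 \<Rightarrow> real) \<Rightarrow> real^2 \<Rightarrow> real^2" where
  "curl_scalar \<phi> x = vector [partial_deriv 2 \<phi> x, - partial_deriv 1 \<phi> x]"

subsection \<open>Classical solutions\<close>

text \<open>
  The equations are imposed at times \<open>t > 0\<close>; at \<open>t = 0\<close> the fields are only required to
  be continuous, so that they attain their initial values.  This covers in particular
  solutions that are continuously differentiable up to \<open>t = 0\<close> with one-sided time
  derivatives there.
\<close>
definition classical_field :: "(real \<Rightarrow> real^2 \<Rightarrow> 'a::real_normed_vector) \<Rightarrow> bool" where
  "classical_field f \<longleftrightarrow>
     continuous_on ({0..} \<times> UNIV) (\<lambda>(t, x). f t x) \<and>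
     (\<forall>t>0. \<forall>x. (\<lambda>(t, x). f t x) differentiable (at (t, x)))"

definition mhd_solution ::
  "(real \<Rightarrow> real^2 \<Rightarrow> real^2) \<Rightarrow> (real \<Rightarrow> real^2 \<Rightarrow> real^2) \<Rightarrow> (real \<Rightarrow> real^2 \<Rightarrow> real) \<Rightarrow> bool"
where
  "mhd_solution u B P \<longleftrightarrow>
     classical_field u \<and> classical_field B \<and>
     (\<forall>t>0. \<forall>x. (\<forall>j. partial_deriv j (u t) differentiable (at x)) \<and> P t differentiable (at x)) \<and>
     (\<forall>t>0. \<forall>x.
        time_deriv u t x + advect (u t) (u t) x - advect (B t) (B t) x
          + grad (\<lambda>y. P t y + (norm (B t y))\<^sup>2 / 2) x = laplacian (u t) x \<and>
        time_deriv B t x - curl_scalar (\<lambda>y. cross2 (u t y) (B t y)) x = 0 \<and>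
        divergence (u t) x = 0 \<and>
        divergence (B t) x = 0)"

text \<open>
  \<open>jacobian (u t) (at x) $ i $ j\<close> is the derivative of \<open>u\<^sub>i\<close> in direction \<open>x\<^sub>j\<close>.
\<close>
definition deformation_solution ::
  "(real \<Rightarrow> real^2 \<Rightarrow> real^2) \<Rightarrow> (real \<Rightarrow> real^2 \<Rightarrow> real^2^2) \<Rightarrow> bool"
where
  "deformation_solution u F \<longleftrightarrow>
     classical_field F \<and>
     (\<forall>t>0. \<forall>x. time_deriv F t x + advect (u t) (F t) x = jacobian (u t) (at x) ** F t x)"

definition flow_map ::
  "(real \<Rightarrow> real^2 \<Rightarrow> real^2) \<Rightarrow> (real \<Rightarrow> real^2 \<Rightarrow> real^2) \<Rightarrow> bool"
where
  "flow_map u X \<longleftrightarrow>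
     (\<forall>\<alpha>. X 0 \<alpha> = \<alpha> \<and>
        (\<forall>t\<ge>0. ((\<lambda>s. X s \<alpha>) has_vector_derivative u t (X t \<alpha>)) (at t within {0..})))"

end

theory Submission
  imports Defs
begin

text \<open>
  Along a trajectory of \<open>u\<close> the columns of \<open>F\<close> solve \<open>p' = (\<nabla>u) p\<close>; since both fields are
  solenoidal, the induction equation says that \<open>B\<close> solves the same linear equation.  For two
  planar solutions \<open>p\<close>, \<open>q\<close> one has \<open>(p \<times> q)' = tr(\<nabla>u) (p \<times> q)\<close>, so every quotient of two such
  cross products is constant.  By Cramer's rule the entries of \<open>F\<inverse> B\<close> are quotients of this form.
\<close>

text \<open>\<open>vector_derivative\<close> is a choice term, informative only where a derivative
  exists. A Frechet derivative pins it down, so every operator below becomes a value of one linear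
  map.\<close>

lemma partial_deriv_has_derivative:
  assumes "(f has_derivative f') (at x)"
  shows "partial_deriv j f x = f' (axis j 1)"
proof -
  have "((\<lambda>s. x + s *\<^sub>R axis j 1) has_derivative (\<lambda>s. s *\<^sub>R axis j 1)) (at 0)"
    by (auto intro!: derivative_eq_intros)
  then have "((\<lambda>s. f (x + s *\<^sub>R axis j 1)) has_derivative (\<lambda>s. f' (s *\<^sub>R axis j 1))) (at 0)"
    by (rule has_derivative_compose) (simp add: assms)
  then have "((\<lambda>s. f (x + s *\<^sub>R axis j 1)) has_vector_derivative f' (axis j 1)) (at 0)"
    by (simp add: has_vector_derivative_def linear_cmul[OF has_derivative_linear[OF assms]])
  then show ?thesis
    unfolding partial_deriv_def by (rule vector_derivative_at)
qed

lemma advect_has_derivative: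
  assumes "(f has_derivative f') (at x)"
  shows "advect v f x = f' (v x)"
proof -
  have lin: "linear f'"
    using assms by (rule has_derivative_linear)
  have "f' (v x) = f' (\<Sum>j\<in>UNIV. v x $ j *\<^sub>R axis j 1)"
    by (simp only: basis_expansion scalar_mult_eq_scaleR[symmetric])
  then show ?thesis
    by (simp add: advect_def partial_deriv_has_derivative[OF assms] linear_sum[OF lin]
        linear_cmul[OF lin])
qed

lemma jacobian_mult_vector:
  fixes f :: "real^'n \<Rightarrow> real^'m"
  assumes "(f has_derivative f') (at x)"
  shows "jacobian f (at x) *v w = f' w"
  unfolding jacobian_def frechet_derivative_at[OF assms, symmetric]
  using has_derivative_linear[OF assms] by (simp add: matrix_vector_mul)

lemma classical_field_slice:
  assumes "classical_field f" "t > 0"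
  shows "f t differentiable (at x)"
proof -
  obtain D where D: "((\<lambda>(t, x). f t x) has_derivative D) (at (t, x))"
    using assms unfolding classical_field_def differentiable_def by blast
  have "(Pair t has_derivative Pair 0) (at x)"
    by (auto intro!: derivative_eq_intros)
  from has_derivative_compose[OF this D] show ?thesis
    unfolding differentiable_def by auto
qed

text \<open>Chain rule for the joint space-time derivative \<open>D\<close> along the curve
  \<open>(s, X s)\<close>: its velocity is \<open>(1, u)\<close>, and linearity splits
  \<open>D (1, u)\<close> into the time part \<open>D (1, 0)\<close> and the transport part
  \<open>D (0, u)\<close>.\<close>

lemma material_derivative:
  assumes f: "classical_field f" and t: "t > 0"
    and X: "(X has_vector_derivative u t (X t)) (at t)"
  shows "((\<lambda>s. f s (X s)) has_vector_derivative
           time_deriv f t (X t) + advect (u t) (f t) (X t)) (at t)"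
proof -
  define x where "x = X t"
  obtain D where D: "((\<lambda>(t, x). f t x) has_derivative D) (at (t, x))"
    using f t unfolding classical_field_def differentiable_def by blast
  have lin: "linear D"
    using D by (rule has_derivative_linear)
  \<comment> \<open>Stated for an arbitrary curve through \<open>x\<close> because it serves twice:
    the constant curve yields \<open>time_deriv\<close>, the trajectory yields the claim.\<close>
  have curve: "((\<lambda>s. f s (c s)) has_vector_derivative D (1, c')) (at t)"
    if c: "(c has_vector_derivative c') (at t)" and ct: "c t = x" for c c'
  proof -
    have "((\<lambda>s. (s, c s)) has_derivative (\<lambda>h. (h, h *\<^sub>R c'))) (at t)"
      by (intro has_derivative_Pair has_derivative_ident c[unfolded has_vector_derivative_def])
    from has_derivative_compose[OF this, unfolded ct, OF D]
    have "((\<lambda>s. f s (c s)) has_derivative (\<lambda>h. D (h, h *\<^sub>R c'))) (at t)"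
      by simp
    moreover have "D (h, h *\<^sub>R c') = h *\<^sub>R D (1, c')" for h
      using linear_cmul[OF lin, of h "(1, c')"] by simp
    ultimately show ?thesis
      unfolding has_vector_derivative_def by simp
  qed
  have time: "time_deriv f t x = D (1, 0)"
    unfolding time_deriv_def
    by (rule vector_derivative_at[OF curve[of "\<lambda>_. x"]]) simp_all
  have "(Pair t has_derivative Pair 0) (at x)"
    by (auto intro!: derivative_eq_intros)
  from has_derivative_compose[OF this D]
  have "(f t has_derivative (\<lambda>h. D (0, h))) (at x)"
    by simp
  then have space: "advect (u t) (f t) x = D (0, u t x)"
    by (rule advect_has_derivative)
  have "D (1, u t x) = D (1, 0) + D (0, u t x)"
    using linear_add[OF lin, of "(1, 0)" "(0, u t x)"] by simp
  then show ?thesis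
    using curve[OF X] unfolding x_def[symmetric] time space by simp
qed

text \<open>The product rule produces two further terms, \<open>v\<close> times the divergence of
  \<open>w\<close> minus \<open>w\<close> times the divergence of \<open>v\<close>; both vanish for
  solenoidal fields.\<close>

lemma curl_scalar_cross2:
  assumes v: "v differentiable (at x)" and w: "w differentiable (at x)"
    and "divergence v x = 0" "divergence w x = 0"
  shows "curl_scalar (\<lambda>y. cross2 (v y) (w y)) x = advect w v x - advect v w x"
proof -
  obtain v' w' where v': "(v has_derivative v') (at x)" and w': "(w has_derivative w') (at x)"
    using v w unfolding differentiable_def by blast
  have comp: "((\<lambda>y. f y $ i) has_derivative (\<lambda>h. f' h $ i)) (at x)"
    if "(f has_derivative f') (at x)" for f f' :: "real^2 \<Rightarrow> real^2" and i
    using that by (rule bounded_linear.has_derivative[OF bounded_linear_vec_nth])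
  have div0: "v' (axis 1 1) $ 1 + v' (axis 2 1) $ 2 = 0" "w' (axis 1 1) $ 1 + w' (axis 2 1) $ 2 = 0"
    using assms(3,4)
    by (simp_all add: divergence_def sum_2 partial_deriv_has_derivative[OF comp[OF v']]
        partial_deriv_has_derivative[OF comp[OF w']])
  have "((\<lambda>y. cross2 (v y) (w y)) has_derivative
      (\<lambda>h. cross2 (v' h) (w x) + cross2 (v x) (w' h))) (at x)"
    unfolding cross2_def
    by (auto intro!: derivative_eq_intros comp[OF v'] comp[OF w'] simp: algebra_simps)
  note cross = partial_deriv_has_derivative[OF this]
  \<comment> \<open>Eliminating one diagonal entry of each gradient leaves a polynomial
    identity.\<close>
  have "v' (axis 2 1) $ 2 = - v' (axis 1 1) $ 1" "w' (axis 2 1) $ 2 = - w' (axis 1 1) $ 1"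
    using div0 by linarith+
  then show ?thesis
    by (simp add: vec_eq_iff forall_2 curl_scalar_def cross advect_def sum_2
        partial_deriv_has_derivative[OF v'] partial_deriv_has_derivative[OF w'])
      (simp add: cross2_def algebra_simps)
qed

text \<open>\<open>cross2 p q\<close> is the determinant with columns \<open>p\<close> and
  \<open>q\<close>, so this is the first-order part in \<epsilon> of det((I + \<epsilon> M) N) =
  det(I + \<epsilon> M) det N.\<close>

lemma cross2_matrix_vector:
  "cross2 (M *v p) q + cross2 p (M *v q) = trace M * cross2 p q"
  by (simp add: cross2_def matrix_vector_mult_def trace_def sum_2 algebra_simps)

text \<open>Liouville's formula for the Wronskian of two solutions of one planar linear
  system.\<close>

lemma has_derivative_cross2_solutions:
  assumes p: "(p has_vector_derivative M *v p t) (at t)"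
    and q: "(q has_vector_derivative M *v q t) (at t)"
  shows "((\<lambda>s. cross2 (p s) (q s)) has_real_derivative trace M * cross2 (p t) (q t)) (at t)"
proof -
  have comp: "((\<lambda>s. r s $ i) has_real_derivative r' $ i) (at t)"
    if "(r has_vector_derivative r') (at t)" for r :: "real \<Rightarrow> real^2" and r' i
    using bounded_linear.has_vector_derivative[OF bounded_linear_vec_nth that]
    by (simp add: has_real_derivative_iff_has_vector_derivative)
  show ?thesis
    unfolding cross2_matrix_vector[symmetric] unfolding cross2_def
    by (auto intro!: derivative_eq_intros comp[OF p] comp[OF q] simp: algebra_simps)
qed

text \<open>Numerator and denominator both solve the scalar equation y' = tr(M) y, so the two terms
  of the quotient rule cancel.\<close>

lemma cross2_quotient_const:
  assumes "\<And>s. s > 0 \<Longrightarrow> (p has_vector_derivative M s *v p s) (at s)"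
    and "\<And>s. s > 0 \<Longrightarrow> (q has_vector_derivative M s *v q s) (at s)"
    and "\<And>s. s > 0 \<Longrightarrow> (p' has_vector_derivative M s *v p' s) (at s)"
    and "\<And>s. s > 0 \<Longrightarrow> (q' has_vector_derivative M s *v q' s) (at s)"
    and "continuous_on {0..} p" "continuous_on {0..} q"
    and "continuous_on {0..} p'" "continuous_on {0..} q'"
    and nz: "\<And>s. s \<ge> 0 \<Longrightarrow> cross2 (p' s) (q' s) \<noteq> 0"
    and t: "t \<ge> 0"
  shows "cross2 (p t) (q t) / cross2 (p' t) (q' t) = cross2 (p 0) (q 0) / cross2 (p' 0) (q' 0)"
proof (cases "t = 0")
  case False
  let ?g = "\<lambda>s. cross2 (p s) (q s) / cross2 (p' s) (q' s)"
  have "continuous_on {0..} ?g"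
    using nz assms(5-8) unfolding cross2_def by (auto intro!: continuous_intros)
  then have "continuous_on {0..t} ?g"
    by (rule continuous_on_subset) auto
  moreover have "(?g has_real_derivative 0) (at s)" if "0 < s" for s
    using that assms(1-4) nz[of s]
    by (auto intro!: derivative_eq_intros has_derivative_cross2_solutions[where M = "M s"])
  \<comment> \<open>The derivative is known only at positive times; continuity on the closed
    interval carries constancy down to time 0.\<close>
  ultimately show ?thesis
    using False t DERIV_isconst2[of 0 t ?g t] by auto
qed simp

lemma matrix_inv_mult_vector_2:
  fixes M :: "real^2^2"
  assumes "det M \<noteq> 0"
  shows "matrix_inv M *v b =
    vector [cross2 b (column 2 M) / cross2 (column 1 M) (column 2 M),
            cross2 (column 1 M) b / cross2 (column 1 M) (column 2 M)]"
proof -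
  have "M *v (matrix_inv M *v b) = b"
    \<comment> \<open>\<open>matrix_inv\<close> is itself a choice term; invertibility supplies the
      witness that makes it a genuine inverse, and Cramer's rule then solves the resulting
      system.\<close>
    using someI_ex[of "\<lambda>N. M ** N = mat 1 \<and> N ** M = mat 1"] assms
    by (simp add: matrix_vector_mul_assoc matrix_inv_def invertible_def flip: invertible_det_nz)
  then show ?thesis
    unfolding cramer[OF assms]
    by (simp add: vec_eq_iff forall_2 det_2 cross2_def column_def mult.commute)
qed

lemma classical_field_trajectory_continuous:
  assumes "classical_field f" "continuous_on {0..} X"
  shows "continuous_on {0..} (\<lambda>s. f s (X s))"
proof -
  have "continuous_on ({0..} \<times> UNIV) (\<lambda>(t, x). f t x)"
    using assms(1) unfolding classical_field_def by blast
  moreover have "continuous_on {0..} (\<lambda>s. (s, X s))"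
    using assms(2) by (intro continuous_intros)
  ultimately have "continuous_on {0..} (\<lambda>s. (\<lambda>(t, x). f t x) (s, X s))"
    by (rule continuous_on_compose2) auto
  then show ?thesis
    by simp
qed

lemma column_matrix_mult: "column j (M ** N) = M *v column j N"
  by (simp add: vec_eq_iff column_def matrix_matrix_mult_def matrix_vector_mult_def)

lemma bounded_linear_column: "bounded_linear (column j :: real^'n^'m \<Rightarrow> real^'m)"
  by (simp add: linear_conv_bounded_linear[symmetric] linear_iff column_def vec_eq_iff)

theorem proposition2p1:
  fixes u B :: "real \<Rightarrow> real^2 \<Rightarrow> real^2"
    and P :: "real \<Rightarrow> real^2 \<Rightarrow> real"
    and F A :: "real \<Rightarrow> real^2 \<Rightarrow> real^2^2"
    and X :: "real \<Rightarrow> real^2 \<Rightarrow> real^2"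
  assumes "mhd_solution u B P"
    and "deformation_solution u F"
    and "\<And>t x. t \<ge> 0 \<Longrightarrow> det (F t x) > 0"
    and "\<And>t x. t \<ge> 0 \<Longrightarrow> A t x = matrix_inv (F t x)"
    and "flow_map u X"
  shows "\<forall>t\<ge>0. \<forall>\<alpha>. A t (X t \<alpha>) *v B t (X t \<alpha>) = A 0 \<alpha> *v B 0 \<alpha>"
proof (intro allI impI)
  fix t :: real and \<alpha> :: "real^2"
  assume t: "t \<ge> 0"
  define x where "x s = X s \<alpha>" for s
  define M where "M s = jacobian (u s) (at (x s))" for s
  define b where "b s = B s (x s)" for s
  define p where "p j s = column j (F s (x s))" for j s
  have u: "classical_field u" and B: "classical_field B" and F: "classical_field F"
    using assms(1,2) by (auto simp: mhd_solution_def deformation_solution_def)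
  have x0: "X 0 \<alpha> = \<alpha>"
    using assms(5) unfolding flow_map_def by blast
  have dx0: "(x has_vector_derivative u s (x s)) (at s within {0..})" if "s \<ge> 0" for s
    using assms(5) that unfolding flow_map_def x_def by auto
  have dx: "(x has_vector_derivative u s (x s)) (at s)" if "s > 0" for s
    using dx0[of s] that at_within_interior[of s "{0..}"] by simp
  have cx: "continuous_on {0..} x"
    using dx0 by (auto simp: continuous_on_eq_continuous_within
        intro: has_vector_derivative_continuous)
  \<comment> \<open>The expanded curl contains minus the transport term of the material derivative;
    after cancellation only \<open>advect B u\<close> remains, which is the gradient of
    \<open>u\<close> applied to \<open>B\<close>.\<close>
  have db: "(b has_vector_derivative M s *v b s) (at s)" if s: "s > 0" for s
  proof -
    have du: "u s differentiable (at (x s))" and dB: "B s differentiable (at (x s))"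
      using u B s by (auto intro: classical_field_slice)
    have "time_deriv B s (x s) = advect (B s) (u s) (x s) - advect (u s) (B s) (x s)"
      using assms(1) s curl_scalar_cross2[OF du dB] by (simp add: mhd_solution_def)
    moreover have "advect (B s) (u s) (x s) = M s *v b s"
      using du unfolding differentiable_def M_def b_def
      by (auto simp: advect_has_derivative jacobian_mult_vector)
    ultimately show ?thesis
      using material_derivative[OF B s, of x u] dx[OF s] by (simp add: b_def[abs_def])
  qed
  have dp: "(p j has_vector_derivative M s *v p j s) (at s)" if s: "s > 0" for j s
  proof -
    have "((\<lambda>s. F s (x s)) has_vector_derivative M s ** F s (x s)) (at s)"
      using material_derivative[OF F s, of x u] dx[OF s] assms(2) s
      by (simp add: deformation_solution_def M_def)
    from bounded_linear.has_vector_derivative[OF bounded_linear_column this, of j]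
    show ?thesis
      by (simp add: p_def[abs_def] column_matrix_mult)
  qed
  have cb: "continuous_on {0..} b"
    unfolding b_def by (rule classical_field_trajectory_continuous[OF B cx])
  have cp: "continuous_on {0..} (p j)" for j
    unfolding p_def
    by (rule bounded_linear.continuous_on[OF bounded_linear_column
          classical_field_trajectory_continuous[OF F cx]])
  \<comment> \<open>This cross product of the columns is the determinant of \<open>F\<close>, the
    common denominator in Cramer's rule.\<close>
  have nz: "cross2 (p 1 s) (p 2 s) \<noteq> 0" if "s \<ge> 0" for s
    using assms(3)[OF that, of "x s"] by (simp add: p_def cross2_def column_def det_2 mult.commute)
  have Ab: "A s (x s) *v b s = vector [cross2 (b s) (p 2 s) / cross2 (p 1 s) (p 2 s),
      cross2 (p 1 s) (b s) / cross2 (p 1 s) (p 2 s)]" if "s \<ge> 0" for s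
    using assms(3)[OF that, of "x s"] assms(4)[OF that]
    by (simp add: p_def matrix_inv_mult_vector_2)
  have "A t (x t) *v b t = A 0 (x 0) *v b 0"
    \<comment> \<open>One application per entry of \<open>A\<close> times \<open>b\<close>: the
      numerator has \<open>b\<close> in place of the first column of \<open>F\<close>, then of the
      second.\<close>
    using cross2_quotient_const[of b M "p 2" "p 1" "p 2", OF db dp dp dp cb cp cp cp nz t]
      cross2_quotient_const[of "p 1" M b "p 1" "p 2", OF dp db dp dp cp cb cp cp nz t]
    by (simp add: Ab t)
  then show "A t (X t \<alpha>) *v B t (X t \<alpha>) = A 0 \<alpha> *v B 0 \<alpha>"
    by (simp add: b_def x_def x0)
qed

end
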